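(* Let $\psi:\mathbb C\to\mathbb C$ be the random entire function $\psi(z)=\sum_{k=0}^\infty \zeta_k z^k/\sqrt{k!}$, where $\zeta_0,\zeta_1,\dots$ are independent standard complex Gaussian random variables, and let $\sigma\in(0,\infty)$ be the absolute constant such that for every compactly supported $C^2$-function $g:\mathbb C\to\mathbb R$, $$\lim_{r\to\infty,\ \lambda\to0,\ \lambda\log^2 r\to0}\ \frac1{r^2\lambda^2}\ln\mathbb E\exp\bigg(\lambda r^2\Big(\sum_{z:\psi(z)=0}g\Big(\frac zr\Big)-\frac{r^2}{\pi}\int g\,dm\Big)\bigg)=\frac{\sigma^2}2\int|\Delta g|^2\,dm$$ (such a constant exists). Let $h:\mathbb C\to\mathbb R$ be a compactly supported $C^2$-function. Then the distribution of $$r\,\Big(\sum_{z:\psi(z)=0}h\Big(\frac zr\Big)-\frac{r^2}\pi\int h\,dm\Big)$$ converges weakly, as $r\to\infty$, to the normal distribution $N\big(0,\sigma^2\int|\Delta h|^2\,dm\big)$.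
   Context: A standard complex Gaussian random variable has density $z\mapsto\pi^{-1}e^{-|z|^2}$ with respect to Lebesgue measure on $\mathbb C$. $m$ is Lebesgue measure on $\mathbb C$; $C^2$ and the Laplacian $\Delta$ are understood under the identification $\mathbb C=\mathbb R^2$. The limit in the claim is a joint limit: for every $\varepsilon>0$ there exist $R$ and $\delta>0$ such that the expression is within $\varepsilon$ of the right-hand side for all $r\ge R$ and all $\lambda\neq0$ with $|\lambda|\log^2r\le\delta$. $N(0,0)$ denotes the unit mass at $0$. *)

theory Defs
  imports "HOL-Probability.Probability"
begin

definition std_complex_gaussian_density :: "complex \<Rightarrow> real" where
  "std_complex_gaussian_density z = exp (- (norm z)\<^sup>2) / pi"

text \<open>
  For independent standard complex Gaussian coefficients the series converges for every
  \<open>z\<close> outside a null event; on that event \<open>suminf\<close> takes unspecified values.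
\<close>

definition gaussian_entire :: "(nat \<Rightarrow> complex) \<Rightarrow> complex \<Rightarrow> complex" where
  "gaussian_entire a z = (\<Sum>k. a k * z ^ k / of_real (sqrt (fact k)))"

text \<open>
  Each zero is counted once. This agrees almost surely with counting multiplicities, since
  the zeros of the Gaussian entire function are almost surely simple. For a nonzero entire
  function \<open>f\<close> and compactly supported \<open>h\<close> the sum has only finitely many nonzero terms.
\<close>

definition centered_zero_sum ::
    "(complex \<Rightarrow> complex) \<Rightarrow> (complex \<Rightarrow> real) \<Rightarrow> real \<Rightarrow> real" where
  "centered_zero_sum f h r =
     (\<Sum>\<^sub>\<infinity>z\<in>{z. f z = 0}. h (z / of_real r)) - r\<^sup>2 / pi * (LINT z|lborel. h z)"

text \<open>
  Twice continuous differentiability in the real sense, on \<open>complex\<close> as a real normed space.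
\<close>

definition C2_real :: "(complex \<Rightarrow> real) \<Rightarrow> bool" where
  "C2_real g \<longleftrightarrow>
     (\<exists>(g' :: complex \<Rightarrow> complex \<Rightarrow>\<^sub>L real) (g'' :: complex \<Rightarrow> complex \<Rightarrow>\<^sub>L complex \<Rightarrow>\<^sub>L real).
        (\<forall>z. (g has_derivative blinfun_apply (g' z)) (at z)) \<and>
        (\<forall>z. (g' has_derivative blinfun_apply (g'' z)) (at z)) \<and>
        continuous_on UNIV g'')"

definition compactly_supported :: "(complex \<Rightarrow> real) \<Rightarrow> bool" where
  "compactly_supported g \<longleftrightarrow> compact (closure {z. g z \<noteq> 0})"

definition laplacian :: "(complex \<Rightarrow> real) \<Rightarrow> complex \<Rightarrow> real" where
  "laplacian g z =
     (deriv ^^ 2) (\<lambda>t::real. g (z + of_real t)) 0 +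
     (deriv ^^ 2) (\<lambda>t::real. g (z + \<i> * of_real t)) 0"

text \<open>The second parameter is the variance; variance \<open>0\<close> gives the unit mass at the mean.\<close>

definition normal_law :: "real \<Rightarrow> real \<Rightarrow> real measure" where
  "normal_law \<mu> v =
     (if v = 0 then return borel \<mu>
      else density lborel (\<lambda>x. ennreal (normal_density \<mu> (sqrt v) x)))"

text \<open>
  The zero sums are measurable functions only up to a null event, so expectations and
  distributions are taken with respect to the completion of the underlying measure. If the
  exponential is not integrable, its Bochner integral and then \<open>ln\<close> of it are \<open>0\<close>. This
  cannot be mistaken for convergence to \<open>\<sigma>\<^sup>2 / 2 * (LINT z|lborel. \<bar>laplacian g z\<bar>\<^sup>2)\<close> with
  \<open>\<sigma> > 0\<close>: that value is positive unless \<open>g\<close> vanishes identically, in which case the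
  exponential is constantly \<open>1\<close>.
\<close>

definition scaled_log_mgf ::
    "'a measure \<Rightarrow> (nat \<Rightarrow> 'a \<Rightarrow> complex) \<Rightarrow> (complex \<Rightarrow> real) \<Rightarrow> real \<Rightarrow> real \<Rightarrow> real" where
  "scaled_log_mgf M \<zeta> g r \<theta> =
     1 / (r\<^sup>2 * \<theta>\<^sup>2) *
     ln (LINT \<omega>|completion M.
           exp (\<theta> * r\<^sup>2 * centered_zero_sum (gaussian_entire (\<lambda>k. \<zeta> k \<omega>)) g r))"

end

theory Submission
  imports Defs "HOL-Real_Asymp.Real_Asymp" "HOL-Complex_Analysis.Complex_Analysis"
begin

text \<open>
  Write \<open>Y r\<close> for the rescaled centred sum and \<open>V\<close> for \<open>\<integral>|\<Delta>h|\<^sup>2\<close>. The choice \<open>\<lambda> = t / r\<close> in the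
  defining property of \<open>\<sigma>\<close> is admissible, because \<open>(ln r)\<^sup>2 / r \<rightarrow> 0\<close>, and turns it into
  \<open>ln E (exp (t * Y r)) \<rightarrow> \<sigma>\<^sup>2 * V * t\<^sup>2 / 2\<close> for each real \<open>t \<noteq> 0\<close>: the moment generating functions
  converge to that of \<open>N(0, \<sigma>\<^sup>2 * V)\<close>. By Curtiss' theorem (\<open>Curtiss_continuity\<close>) this forces weak
  convergence.

  Curtiss' theorem is reduced to Levy's continuity theorem by analytic continuation. On a vertical
  strip around the imaginary axis the functions \<open>z \<mapsto> E (exp (z * Y))\<close> are holomorphic and uniformly
  bounded, and they converge on a real interval; a theorem of Vitali (\<open>Vitali_pointwise\<close>, from
  Montel's theorem and the identity theorem) extends the convergence to the imaginary axis, where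
  these functions are the characteristic functions.

  Measurability of \<open>Y r\<close> with respect to the completed measure comes for free when \<open>V > 0\<close>: the
  limit of the logarithms is then nonzero, so for large \<open>r\<close> the Bochner integral of \<open>exp (\<plusminus> Y r)\<close> is
  not the default value of a non-integrable function, and \<open>Y r\<close> is the logarithm of an integrable
  function. If \<open>V = 0\<close>, then \<open>h\<close> is harmonic with compact support, hence zero by the maximum
  principle, and the limit is the unit mass at \<open>0\<close>.
\<close>

section \<open>Pointwise convergence of holomorphic functions\<close>

text \<open>
  If convergence failed at \<open>z\<close>, some subsequence would stay away from \<open>G z\<close>. By Montel's theorem a
  further subsequence has a holomorphic limit; that limit agrees with \<open>G\<close> on \<open>U\<close>, hence at \<open>z\<close>.
\<close>
lemma Vitali_pointwise:
  fixes F :: "nat \<Rightarrow> complex \<Rightarrow> complex"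
  assumes S: "open S" "connected S"
    and hol: "\<And>n. F n holomorphic_on S"
    and bdd: "\<And>K. compact K \<Longrightarrow> K \<subseteq> S \<Longrightarrow> \<exists>B. \<forall>n. \<forall>z\<in>K. norm (F n z) \<le> B"
    and G: "G holomorphic_on S"
    and U: "U \<subseteq> S" "\<xi> \<in> S" "\<xi> islimpt U"
    and lim: "\<And>z. z \<in> U \<Longrightarrow> (\<lambda>n. F n z) \<longlonglongrightarrow> G z"
    and z: "z \<in> S"
  shows "(\<lambda>n. F n z) \<longlonglongrightarrow> G z"
proof (rule ccontr)
  assume "\<not> ?thesis"
  then obtain e where e: "e > 0" "\<exists>\<^sub>F n in sequentially. e \<le> dist (F n z) (G z)"
    by (auto simp: tendsto_iff frequently_def not_le)
  then have "infinite {n. e \<le> dist (F n z) (G z)}"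
    by (simp add: frequently_cofinite flip: cofinite_eq_sequentially)
  then obtain q :: "nat \<Rightarrow> nat" where q: "strict_mono q" "\<And>n. e \<le> dist (F (q n) z) (G z)"
    using infinite_enumerate by (metis mem_Collect_eq)
  have "\<exists>B. \<forall>h\<in>range (\<lambda>n. F (q n)). \<forall>z\<in>K. norm (h z) \<le> B"
    if "compact K" "K \<subseteq> S" for K
    using bdd[OF that] by auto
  then obtain g p where g: "g holomorphic_on S" "strict_mono (p :: nat \<Rightarrow> nat)"
      "\<And>x. x \<in> S \<Longrightarrow> (\<lambda>n. F (q (p n)) x) \<longlonglongrightarrow> g x"
    using Montel[OF S(1), of "range (\<lambda>n. F (q n))" "\<lambda>n. F (q n)"] hol
    by (smt (verit, best) image_iff order_refl)
  have "g w = G w" if "w \<in> U" for w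
  proof (rule LIMSEQ_unique)
    show "(\<lambda>n. F (q (p n)) w) \<longlonglongrightarrow> g w" using g(3) that U by auto
    show "(\<lambda>n. F (q (p n)) w) \<longlonglongrightarrow> G w"
      using LIMSEQ_subseq_LIMSEQ[OF lim[OF that] strict_mono_o[OF q(1) g(2)]] by (simp add: o_def)
  qed
  then have "g z - G z = 0"
    using analytic_continuation[of "\<lambda>w. g w - G w" S U \<xi> z] S U z g(1) G
    by (auto intro: holomorphic_intros)
  moreover have "(\<lambda>n. dist (F (q (p n)) z) (G z)) \<longlonglongrightarrow> dist (g z) (G z)"
    by (intro tendsto_intros g(3) z)
  then have "e \<le> dist (g z) (G z)"
    by (rule LIMSEQ_le_const) (use q(2) in auto)
  ultimately have "e \<le> 0" by simp
  with e show False by simp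
qed

section \<open>Moment generating functions\<close>

abbreviation mgf :: "real measure \<Rightarrow> complex \<Rightarrow> complex" where
  "mgf M z \<equiv> CLINT x|M. exp (z * of_real x)"

text \<open>
  This turns exponential integrability at the two end points \<open>a\<close> and \<open>-a\<close> into a majorant for the
  whole strip.
\<close>
lemma exp_mult_abs_le: "exp (b * \<bar>x\<bar>) \<le> exp (a * x) + exp (- a * x)" if "b \<le> a" for a b x :: real
proof -
  have "exp (b * \<bar>x\<bar>) \<le> exp (a * \<bar>x\<bar>)" using that by (simp add: mult_right_mono)
  also have "\<dots> \<le> exp (a * x) + exp (- a * x)" by (cases "x \<ge> 0") (auto simp: abs_if)
  finally show ?thesis .
qed

lemma norm_exp_mult_le: "norm (exp (z * of_real x)) \<le> exp (\<bar>Re z\<bar> * \<bar>x\<bar>)" for z :: complex and x :: real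
  by (metis Re_complex_of_real abs_ge_self abs_mult complex_Re_le_cmod exp_le_cancel_iff norm_exp_eq_Re times_complex.simps(1) Im_complex_of_real mult_zero_right diff_zero)

text \<open>
  Differentiation under the integral sign. At \<open>z\<close> there is the margin \<open>2 * d = a - \<bar>Re z\<bar>\<close> to the
  boundary of the strip. One \<open>d\<close> pays for the increment of the argument, the other for the factor
  \<open>x\<close> produced by the difference quotient, since \<open>d * \<bar>x\<bar> \<le> exp (d * \<bar>x\<bar>)\<close>; so
  \<open>(exp (a * x) + exp (- a * x)) / d\<close> dominates all small difference quotients.
\<close>
lemma holomorphic_on_mgf:
  fixes M :: "real measure"
  assumes M: "sets M = sets borel" 
    and int: "integrable M (\<lambda>x. exp (a * x))" "integrable M (\<lambda>x. exp (- a * x))"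
  shows "mgf M holomorphic_on {z. \<bar>Re z\<bar> < a}"
proof -
  have meas: "(\<lambda>x. exp (w * of_real x)) \<in> borel_measurable M" for w :: complex
    unfolding measurable_cong_sets[OF M refl]
    by (intro borel_measurable_continuous_onI continuous_intros)
  have "(mgf M has_field_derivative (CLINT x|M. of_real x * exp (z * of_real x))) (at z)"
    if z: "\<bar>Re z\<bar> < a" for z
    unfolding DERIV_def
  proof (subst LIMSEQ_SEQ_conv[symmetric], safe)
    fix X :: "nat \<Rightarrow> complex" assume nz: "\<forall>n. X n \<noteq> 0" and X: "X \<longlonglongrightarrow> 0"
    define d where "d = (a - \<bar>Re z\<bar>) / 2"
    have d: "d > 0" using z by (simp add: d_def)
    obtain N where N: "\<And>n. n \<ge> N \<Longrightarrow> norm (X n) < d"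
      using tendstoD[OF X d] by (auto simp: eventually_sequentially)
    have ez: "integrable M (\<lambda>x. exp (w * of_real x))" if "\<bar>Re w\<bar> \<le> a" for w
    proof (rule Bochner_Integration.integrable_bound[OF Bochner_Integration.integrable_add[OF int]])
      show "AE x in M. norm (exp (w * of_real x)) \<le> norm (exp (a * x) + exp (- a * x))"
        using order_trans[OF norm_exp_mult_le exp_mult_abs_le[OF that]]
        by (intro AE_I2) (simp add: abs_of_pos add_pos_pos del: norm_exp_eq_Re)
    qed (rule meas)
    have "(\<lambda>n. CLINT x|M. (exp ((z + X (n+N)) * of_real x) - exp (z * of_real x)) / X (n+N))
        \<longlonglongrightarrow> (CLINT x|M. of_real x * exp (z * of_real x))"
    proof (rule integral_dominated_convergence)
      show "integrable M (\<lambda>x. (exp (a * x) + exp (- a * x)) / d)"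
        using int by (intro integrable_divide Bochner_Integration.integrable_add)
      show "AE x in M. (\<lambda>n. (exp ((z + X (n+N)) * of_real x) - exp (z * of_real x)) / X (n+N))
          \<longlonglongrightarrow> of_real x * exp (z * of_real x)"
      proof (rule AE_I2)
        fix x :: real
        have "((\<lambda>z. exp (z * of_real x)) has_field_derivative of_real x * exp (z * of_real x)) (at z)"
          by (auto intro!: derivative_eq_intros)
        then show "(\<lambda>n. (exp ((z + X (n+N)) * of_real x) - exp (z * of_real x)) / X (n+N))
          \<longlonglongrightarrow> of_real x * exp (z * of_real x)"
          unfolding DERIV_def LIMSEQ_SEQ_conv[symmetric]
          using nz LIMSEQ_ignore_initial_segment[OF X] by simp
      qed
      fix n
      let ?w = "X (n+N)"
      show "AE x in M. norm ((exp ((z + ?w) * of_real x) - exp (z * of_real x)) / ?w)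
          \<le> (exp (a * x) + exp (- a * x)) / d"
      proof (rule AE_I2)
        fix x :: real
        have w: "norm ?w < d" "norm ?w > 0" using N[of "n+N"] nz by auto
        have "(exp ((z + ?w) * of_real x) - exp (z * of_real x)) / ?w
            = exp (z * of_real x) * (exp (?w * of_real x) - 1) / ?w"
          by (simp add: ring_distribs exp_add)
        then have "norm ((exp ((z + ?w) * of_real x) - exp (z * of_real x)) / ?w)
            = norm (exp (z * of_real x)) * norm (exp (?w * of_real x) - 1) / norm ?w"
          by (simp only: norm_mult norm_divide)
        also have "\<dots> \<le> exp (\<bar>Re z\<bar> * \<bar>x\<bar>) * (exp (d * \<bar>x\<bar>) * (norm ?w * \<bar>x\<bar>)) / norm ?w"
        proof (intro divide_right_mono mult_mono norm_exp_mult_le)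
          have "norm (exp (?w * of_real x) - 1) \<le> exp (norm (?w * of_real x)) * norm (?w * of_real x)"
            using Taylor_exp_field[of "?w * of_real x" 0] by simp
          also have "\<dots> \<le> exp (d * \<bar>x\<bar>) * (norm ?w * \<bar>x\<bar>)"
            using w by (intro mult_mono) (auto simp: norm_mult mult_right_mono)
          finally show "norm (exp (?w * of_real x) - 1) \<le> exp (d * \<bar>x\<bar>) * (norm ?w * \<bar>x\<bar>)" .
        qed auto
        also have "\<dots> = exp ((\<bar>Re z\<bar> + d) * \<bar>x\<bar>) * (d * \<bar>x\<bar>) / d"
          using w d by (simp add: ring_distribs exp_add)
        also have "\<dots> \<le> exp ((\<bar>Re z\<bar> + d) * \<bar>x\<bar>) * exp (d * \<bar>x\<bar>) / d"
          using d order_trans[OF less_imp_le[OF less_add_one] exp_ge_add_one_self[of "d * \<bar>x\<bar>", unfolded add.commute[of 1]]]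
          by (intro divide_right_mono mult_left_mono) auto
        also have "\<dots> = exp ((\<bar>Re z\<bar> + d + d) * \<bar>x\<bar>) / d"
          by (simp add: distrib_right mult_exp_exp)
        also have "\<dots> \<le> (exp (a * x) + exp (- a * x)) / d"
          using d by (intro divide_right_mono exp_mult_abs_le) (auto simp: d_def)
        finally show "norm ((exp ((z + ?w) * of_real x) - exp (z * of_real x)) / ?w)
          \<le> (exp (a * x) + exp (- a * x)) / d" .
      qed
    next
      have "complex_of_real \<in> borel_measurable M"
        unfolding measurable_cong_sets[OF M refl] by simp
      then show "(\<lambda>x. of_real x * exp (z * of_real x)) \<in> borel_measurable M"
        by (intro borel_measurable_times meas)
      show "(\<lambda>x. (exp ((z + X (n+N)) * of_real x) - exp (z * of_real x)) / X (n+N)) \<in> borel_measurable M" for n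
        by (intro borel_measurable_divide borel_measurable_diff meas borel_measurable_const)
    qed
    also have "(\<lambda>n. CLINT x|M. (exp ((z + X (n+N)) * of_real x) - exp (z * of_real x)) / X (n+N))
       = (\<lambda>n. (mgf M (z + X (n+N)) - mgf M z) / X (n+N))"
    proof
      fix n
      have "\<bar>Re (z + X (n+N))\<bar> \<le> a"
        using N[of "n+N"] abs_Re_le_cmod[of "X (n+N)"] abs_triangle_ineq[of "Re z" "Re (X (n+N))"] z
        unfolding d_def plus_complex.sel by (simp add: field_simps)
      then show "(CLINT x|M. (exp ((z + X (n+N)) * of_real x) - exp (z * of_real x)) / X (n+N))
         = (mgf M (z + X (n+N)) - mgf M z) / X (n+N)"
        using ez[of z] ez[of "z + X (n+N)"] z by simp
    qed
    finally show "(\<lambda>n. (mgf M (z + X n) - mgf M z) / X n)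
        \<longlonglongrightarrow> (CLINT x|M. of_real x * exp (z * of_real x))"
      by (rule LIMSEQ_offset)
  qed
  then show ?thesis
    by (auto simp: holomorphic_on_def field_differentiable_def intro: has_field_derivative_at_within)
qed

text \<open>
  The end points \<open>a\<close> and \<open>-a\<close> give a bound that is uniform on the strip \<open>\<bar>Re z\<bar> < a\<close>; convergence on
  the real interval inside it determines the limit everywhere on the strip, in particular on the
  imaginary axis.
\<close>
theorem Curtiss_continuity:
  fixes \<mu> :: "nat \<Rightarrow> real measure" and \<nu> :: "real measure"
  assumes \<mu>: "\<And>n. real_distribution (\<mu> n)" and \<nu>: "real_distribution \<nu>" and a: "a > 0"
    and int_\<mu>: "\<And>n t. \<bar>t\<bar> \<le> a \<Longrightarrow> integrable (\<mu> n) (\<lambda>x. exp (t * x))"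
    and int_\<nu>: "\<And>t. \<bar>t\<bar> \<le> a \<Longrightarrow> integrable \<nu> (\<lambda>x. exp (t * x))"
    and lim: "\<And>t. \<bar>t\<bar> \<le> a \<Longrightarrow> (\<lambda>n. LINT x|\<mu> n. exp (t * x)) \<longlonglongrightarrow> (LINT x|\<nu>. exp (t * x))"
  shows "weak_conv_m \<mu> \<nu>"
proof (rule levy_continuity[OF \<mu> \<nu>])
  fix t :: real
  let ?S = "{z. \<bar>Re z\<bar> < a}"
  have sets: "sets (\<mu> n) = sets borel" "sets \<nu> = sets borel" for n
    using real_distribution.events_eq_borel[OF \<mu>] real_distribution.events_eq_borel[OF \<nu>] by auto
  have real: "mgf M (of_real s) = of_real (LINT x|M. exp (s * x))" for M s
    unfolding integral_complex_of_real[symmetric] by (simp flip: of_real_mult add: exp_of_real)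
  have "open ?S" 
    by (intro open_Collect_less continuous_intros)
  have "?S = Re -` {-a<..<a}" by (auto simp: abs_less_iff)
  then have "convex ?S" 
    by (simp add: convex_linear_vimage bounded_linear.linear[OF bounded_linear_Re])
  then have "connected ?S" by (rule convex_connected)
  have "Bseq (\<lambda>n. (LINT x|\<mu> n. exp (a * x)) + (LINT x|\<mu> n. exp (- a * x)))"
    using tendsto_add[OF lim[of a] lim[of "-a"]] a
    by (intro convergent_imp_Bseq convergentI) simp_all
  then obtain B where B: "\<bar>(LINT x|\<mu> n. exp (a * x)) + (LINT x|\<mu> n. exp (- a * x))\<bar> \<le> B" for n
    unfolding Bseq_def real_norm_def by blast
  have bdd: "norm (mgf (\<mu> n) z) \<le> B" if "z \<in> ?S" for n z
  proof -
    have "norm (mgf (\<mu> n) z) \<le> (LINT x|\<mu> n. norm (exp (z * of_real x)))"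
      by (rule integral_norm_bound)
    also have "\<dots> \<le> (LINT x|\<mu> n. exp (a * x) + exp (- a * x))"
    proof (rule integral_mono')
      show "norm (exp (z * of_real x)) \<le> exp (a * x) + exp (- a * x)" for x
        by (rule order_trans[OF norm_exp_mult_le exp_mult_abs_le]) (use that in simp)
    qed (use int_\<mu>[of a n] int_\<mu>[of "-a" n] a in \<open>auto simp: add_nonneg_nonneg\<close>)
    also have "\<dots> \<le> B" using abs_le_D1[OF B[of n]] int_\<mu>[of a] int_\<mu>[of "-a"] a by simp
    finally show ?thesis .
  qed
  have "(0::complex) islimpt of_real ` {-a<..<a}"
    unfolding islimpt_approachable
  proof (intro allI impI)
    fix e :: real assume "e > 0"
    then show "\<exists>x'\<in>complex_of_real ` {- a<..<a}. x' \<noteq> 0 \<and> dist x' 0 < e"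
      using a by (intro bexI[of _ "of_real (min (a/2) (e/2))"]) auto
  qed
  have "(\<lambda>n. mgf (\<mu> n) (\<i> * of_real t)) \<longlonglongrightarrow> mgf \<nu> (\<i> * of_real t)"
  proof (rule Vitali_pointwise[where F = "\<lambda>n. mgf (\<mu> n)" and G = "mgf \<nu>" and S = ?S
        and U = "of_real ` {-a<..<a}" and \<xi> = 0])
    show "mgf (\<mu> n) holomorphic_on ?S" for n
      using int_\<mu>[of a n] int_\<mu>[of "- a" n] a by (intro holomorphic_on_mgf sets) simp_all
    show "mgf \<nu> holomorphic_on ?S"
      using int_\<nu>[of a] int_\<nu>[of "- a"] a by (intro holomorphic_on_mgf sets) simp_all
    show "\<exists>B. \<forall>n. \<forall>z\<in>K. norm (mgf (\<mu> n) z) \<le> B" if "K \<subseteq> ?S" for K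
      using bdd that by blast
    show "0 islimpt complex_of_real ` {-a<..<a}" by fact
    show "(\<lambda>n. mgf (\<mu> n) z) \<longlonglongrightarrow> mgf \<nu> z" if z: "z \<in> of_real ` {-a<..<a}" for z
    proof -
      obtain s where "z = of_real s" "\<bar>s\<bar> \<le> a" using z by auto
      then show ?thesis unfolding \<open>z = of_real s\<close> real by (intro tendsto_of_real lim)
    qed
  qed (use a \<open>open ?S\<close> \<open>connected ?S\<close> in auto)
  then show "(\<lambda>n. char (\<mu> n) t) \<longlonglongrightarrow> char \<nu> t"
    by (simp add: char_def mult.assoc)
qed

text \<open>
  Completing the square: tilting the centred normal density by \<open>exp (t * x)\<close> gives a multiple of the
  normal density centred at \<open>s\<^sup>2 * t\<close>.
\<close>
lemma normal_mgf:
  assumes "s > 0"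
  shows "has_bochner_integral (density lborel (\<lambda>x. ennreal (normal_density 0 s x)))
     (\<lambda>x. exp (t * x)) (exp (s\<^sup>2 * t\<^sup>2 / 2))"
proof -
  have "normal_density 0 s x * exp (t * x) = exp (s\<^sup>2 * t\<^sup>2 / 2) * normal_density (s\<^sup>2 * t) s x" for x
  proof -
    have "- x\<^sup>2 / (2 * s\<^sup>2) + t * x = s\<^sup>2 * t\<^sup>2 / 2 - (x - s\<^sup>2 * t)\<^sup>2 / (2 * s\<^sup>2)"
      using assms by (simp add: field_simps power2_eq_square)
    then show ?thesis
      by (simp add: normal_density_def flip: exp_add)
  qed
  moreover have "has_bochner_integral lborel (normal_density (s\<^sup>2 * t) s) 1"
    using assms by (simp add: has_bochner_integral_iff)
  ultimately show ?thesis
    by (subst has_bochner_integral_density)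
       (use has_bochner_integral_mult_right[of "exp (s\<^sup>2 * t\<^sup>2 / 2)" lborel _ 1] in auto)
qed

section \<open>Harmonic functions with compact support\<close>

lemma second_derivative_nonpos_at_max:
  fixes f f' :: "real \<Rightarrow> real"
  assumes f: "\<And>t. (f has_real_derivative f' t) (at t)"
    and f': "(f' has_real_derivative c) (at 0)"
    and d: "d > 0" and max: "\<And>t. \<bar>t\<bar> < d \<Longrightarrow> f t \<le> f 0"
  shows "c \<le> 0"
proof (rule ccontr)
  assume "\<not> c \<le> 0"
  then obtain e where e: "e > 0" "\<And>h. 0 < h \<Longrightarrow> h < e \<Longrightarrow> f' 0 < f' h"
    using DERIV_pos_inc_right[OF f'] by auto
  have "f' 0 = 0"
    by (rule DERIV_local_max[OF f d]) (use max in auto)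
  define h where "h = min d e / 2"
  have h: "0 < h" "h < d" "h < e" using d e by (auto simp: h_def)
  obtain x where "0 < x" "x < h" "f h - f 0 = (h - 0) * f' x"
    using MVT2[of 0 h f f'] f h by auto
  moreover have "f' x > 0" using e \<open>f' 0 = 0\<close> calculation h by fastforce
  ultimately show False using max[of h] h by (smt (verit) mult_pos_pos)
qed

lemma directional_derivatives:
  fixes g :: "complex \<Rightarrow> real" and g' :: "complex \<Rightarrow> complex \<Rightarrow>\<^sub>L real"
    and g'' :: "complex \<Rightarrow> complex \<Rightarrow>\<^sub>L complex \<Rightarrow>\<^sub>L real"
  assumes g: "\<And>z. (g has_derivative blinfun_apply (g' z)) (at z)"
    and g': "\<And>z. (g' has_derivative blinfun_apply (g'' z)) (at z)"
  shows "((\<lambda>t. g (z + of_real t * v)) has_real_derivative g' (z + of_real t * v) v) (at t)"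
    and "((\<lambda>t. g' (z + of_real t * v) v) has_real_derivative g'' (z + of_real t * v) v v) (at t)"
proof -
  have lin: "((\<lambda>t. z + of_real t * v) has_derivative (\<lambda>s. of_real s * v)) (at t)" for t :: real
    by (auto intro!: derivative_eq_intros)
  have scale: "L (of_real s * v) = s *\<^sub>R L v" for s :: real and L :: "complex \<Rightarrow>\<^sub>L 'b::real_normed_vector"
    by (metis blinfun.scaleR_right scaleR_conv_of_real)
  show "((\<lambda>t. g (z + of_real t * v)) has_real_derivative g' (z + of_real t * v) v) (at t)"
    using has_derivative_compose[OF lin g]
    by (simp add: has_field_derivative_def scale mult.commute[of _ "g' _ _"])
  have "((\<lambda>t. g' (z + of_real t * v)) has_derivative (\<lambda>s. s *\<^sub>R g'' (z + of_real t * v) v)) (at t)"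
    using has_derivative_compose[OF lin g'] by (simp add: scale)
  from blinfun.FDERIV[OF this has_derivative_const]
  show "((\<lambda>t. g' (z + of_real t * v) v) has_real_derivative g'' (z + of_real t * v) v v) (at t)"
    by (simp add: has_field_derivative_def mult.commute[of _ "g'' _ _ _"] blinfun.bilinear_simps)
qed

lemma laplacian_eq_second_derivative:
  fixes g :: "complex \<Rightarrow> real" and g' :: "complex \<Rightarrow> complex \<Rightarrow>\<^sub>L real"
    and g'' :: "complex \<Rightarrow> complex \<Rightarrow>\<^sub>L complex \<Rightarrow>\<^sub>L real"
  assumes g: "\<And>z. (g has_derivative blinfun_apply (g' z)) (at z)"
    and g': "\<And>z. (g' has_derivative blinfun_apply (g'' z)) (at z)"
  shows "laplacian g z = g'' z 1 1 + g'' z \<i> \<i>"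
proof -
  have "(deriv ^^ 2) (\<lambda>t::real. g (z + of_real t * v)) 0 = g'' z v v" for v
  proof -
    have "deriv (\<lambda>t::real. g (z + of_real t * v)) = (\<lambda>t. g' (z + of_real t * v) v)"
      by (intro ext DERIV_imp_deriv directional_derivatives(1)[OF g g'])
    then show ?thesis
      using DERIV_imp_deriv[OF directional_derivatives(2)[OF g g', of z v 0]]
      by (simp add: numeral_2_eq_2)
  qed
  from this[of 1] this[of \<i>] show ?thesis
    by (simp add: laplacian_def mult.commute)
qed

text \<open>
  The weak maximum principle. The perturbation \<open>f z = g z + e * \<bar>z\<bar>\<^sup>2\<close> has positive Laplacian, so at an
  interior maximum over a large disc its pure second derivatives could not both be nonpositive.
  Hence its maximum \<open>e * R\<^sup>2\<close> is attained on the boundary circle, where \<open>g\<close> vanishes.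
\<close>
lemma subharmonic_compact_support_nonpos:
  fixes g :: "complex \<Rightarrow> real"
  assumes "C2_real g" "compactly_supported g" and lap: "\<And>z. laplacian g z \<ge> 0"
  shows "g w \<le> 0"
proof -
  obtain g' g'' where g: "\<And>z. (g has_derivative blinfun_apply (g' z)) (at z)"
    "\<And>z. (g' has_derivative blinfun_apply (g'' z)) (at z)"
    using assms(1) by (auto simp: C2_real_def)
  obtain R0 where R0: "\<And>z. g z \<noteq> 0 \<Longrightarrow> norm z \<le> R0"
    using assms(2) unfolding compactly_supported_def
    by (metis (mono_tags, lifting) bounded_iff closure_subset compact_imp_bounded mem_Collect_eq subset_iff)
  define R where "R = max R0 (norm w) + 1"
  have R: "norm w < R" "R > 0" "\<And>z. norm z = R \<Longrightarrow> g z = 0" 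
    using R0 norm_ge_zero[of w] by (force simp: R_def simp del: norm_ge_zero)+
  have "g w \<le> e * R\<^sup>2" if e: "e > 0" for e
  proof -
    define f where "f z = g z + e * (norm z)\<^sup>2" for z
    have "continuous_on (cball 0 R) f"
      unfolding f_def using g(1)
      by (intro continuous_intros continuous_at_imp_continuous_on ballI has_derivative_continuous[OF g(1)])
    then obtain z where z: "norm z \<le> R" "\<And>y. norm y \<le> R \<Longrightarrow> f y \<le> f z"
      using continuous_attains_sup[of "cball (0::complex) R" f] R(2) by auto
    have "norm z = R"
    proof (rule ccontr)
      assume "norm z \<noteq> R"
      with z have d: "R - norm z > 0" by simp
      have "g'' z v v + 2 * e \<le> 0" if v: "norm v = 1" for v
      proof (rule second_derivative_nonpos_at_max[OF _ _ d])
        let ?f = "\<lambda>t::real. g (z + of_real t * v) + e * ((Re z + t * Re v)\<^sup>2 + (Im z + t * Im v)\<^sup>2)"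
        let ?f' = "\<lambda>t::real. g' (z + of_real t * v) v + e * (2 * (Re z + t * Re v) * Re v + 2 * (Im z + t * Im v) * Im v)"
        have [simp]: "(Re v)\<^sup>2 + (Im v)\<^sup>2 = 1" using v by (simp add: cmod_def)
        show "(?f has_real_derivative ?f' t) (at t)" for t
          by (intro DERIV_add directional_derivatives(1)[OF g])
            (auto intro!: derivative_eq_intros simp: algebra_simps)
        have "((\<lambda>t. e * (2 * (Re z + t * Re v) * Re v + 2 * (Im z + t * Im v) * Im v))
            has_real_derivative e * (2 * ((Re v)\<^sup>2 + (Im v)\<^sup>2))) (at 0)"
          by (auto intro!: derivative_eq_intros simp: power2_eq_square algebra_simps)
        from DERIV_add[OF directional_derivatives(2)[OF g, of z v 0] this]
        show "(?f' has_real_derivative g'' z v v + 2 * e) (at 0)" by (simp add: mult.commute)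
        have f: "?f t = f (z + of_real t * v)" for t by (simp add: f_def cmod_power2)
        show "?f t \<le> ?f 0" if "\<bar>t\<bar> < R - norm z" for t
          unfolding f
        proof -
          have "norm (z + of_real t * v) \<le> R"
            using norm_triangle_ineq[of z "of_real t * v"] v that by (simp add: norm_mult)
          then show "f (z + of_real t * v) \<le> f (z + of_real 0 * v)" using z by simp
        qed
      qed
      from this[of 1] this[of \<i>] lap[of z] e show False
        by (simp add: laplacian_eq_second_derivative[OF g])
    qed
    then have "f z = e * R\<^sup>2" using R(3) by (simp add: f_def)
    moreover have "f w \<le> f z" using z(2)[of w] R(1) by simp
    moreover have "g w \<le> f w" using e by (simp add: f_def)
    ultimately show ?thesis by linarith
  qed
  note bound = this
  have "g w \<le> 0 + e" if "e > 0" for e :: real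
    using R(2) that bound[of "e / R\<^sup>2"] by simp
  then show ?thesis by (rule field_le_epsilon)
qed

text \<open>
  The Laplacian is continuous with compact support, so vanishing energy makes it vanish everywhere;
  the maximum principle then applies to both \<open>h\<close> and \<open>-h\<close>.
\<close>
lemma eq_0_if_laplacian_energy_0:
  assumes h: "C2_real h" "compactly_supported h" and 0: "(LINT z|lborel. \<bar>laplacian h z\<bar>\<^sup>2) = 0"
  shows "h = (\<lambda>_. 0)"
proof -
  obtain h' h'' where d: "\<And>z. (h has_derivative blinfun_apply (h' z)) (at z)"
    "\<And>z. (h' has_derivative blinfun_apply (h'' z)) (at z)" "continuous_on UNIV h''"
    using h(1) by (auto simp: C2_real_def)
  let ?K = "closure {z. h z \<noteq> 0}"
  have K: "compact ?K" using h(2) by (simp add: compactly_supported_def)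
  have cont: "continuous_on UNIV (\<lambda>z. \<bar>laplacian h z\<bar>\<^sup>2)"
    unfolding laplacian_eq_second_derivative[OF d(1,2)]
    by (intro continuous_intros d(3))
  have out: "laplacian h z = 0" if "z \<notin> ?K" for z
  proof -
    have op: "open (- ?K)" by (intro open_Compl closed_closure)
    have h0: "h y = 0" if "y \<in> - ?K" for y using that closure_subset[of "{z. h z \<noteq> 0}"] by blast
    have h'0: "h' y = 0" if y: "y \<in> - ?K" for y
    proof -
      have "(h has_derivative (\<lambda>_. 0)) (at y)"
        by (rule has_derivative_transform_within_open[OF has_derivative_const op y]) (rule h0[symmetric])
      from has_derivative_unique[OF d(1) this] show ?thesis by (intro blinfun_eqI) simp
    qed
    have "(h' has_derivative (\<lambda>_. 0)) (at z)"
      by (rule has_derivative_transform_within_open[OF has_derivative_const op _ h'0[symmetric]])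
        (use that in simp)
    from has_derivative_unique[OF d(2) this] have "h'' z = 0" by (intro blinfun_eqI) simp
    then show ?thesis by (simp add: laplacian_eq_second_derivative[OF d(1,2)])
  qed
  have "integrable lborel (\<lambda>z. indicator ?K z *\<^sub>R \<bar>laplacian h z\<bar>\<^sup>2)"
    using borel_integrable_compact[OF K continuous_on_subset[OF cont]] by (simp add: set_integrable_def)
  moreover have "(\<lambda>z. indicator ?K z *\<^sub>R \<bar>laplacian h z\<bar>\<^sup>2) = (\<lambda>z. \<bar>laplacian h z\<bar>\<^sup>2)"
  proof
    fix z show "indicator ?K z *\<^sub>R \<bar>laplacian h z\<bar>\<^sup>2 = \<bar>laplacian h z\<bar>\<^sup>2"
      by (cases "z \<in> ?K") (simp_all add: out)
  qed
  ultimately have "integrable lborel (\<lambda>z. \<bar>laplacian h z\<bar>\<^sup>2)" by simp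
  then have "AE z in lborel. \<bar>laplacian h z\<bar>\<^sup>2 = 0"
    using 0 by (subst (asm) integral_nonneg_eq_0_iff_AE) simp_all
  then have "AE z in lborel. laplacian h z = 0" by simp
  then have ae: "AE z in lebesgue. z \<in> {z. laplacian h z = 0}"
    by (simp add: AE_completion)
  have "closed {z. laplacian h z = 0}"
    unfolding laplacian_eq_second_derivative[OF d(1,2)]
    by (intro closed_Collect_eq continuous_intros d(3))
  then have lap: "laplacian h z = 0" for z
    using mem_closed_if_AE_lebesgue[OF _ ae, of z] by simp
  show ?thesis
  proof
    fix z
    have nd: "((\<lambda>z. - h z) has_derivative (- h' z)) (at z)" "((\<lambda>z. - h' z) has_derivative (- h'' z)) (at z)" for z
      using has_derivative_minus[OF d(1)] has_derivative_minus[OF d(2)]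
      by (simp_all add: uminus_blinfun.rep_eq fun_Compl_def)
    have "C2_real (\<lambda>z. - h z)"
      unfolding C2_real_def using nd d(3)
      by (intro exI[of _ "\<lambda>z. - h' z"] exI[of _ "\<lambda>z. - h'' z"]) (auto intro: continuous_intros)
    moreover have "compactly_supported (\<lambda>z. - h z)"
      using h(2) by (simp add: compactly_supported_def)
    moreover have "laplacian (\<lambda>z. - h z) y = 0" for y
      using lap[of y] unfolding laplacian_eq_second_derivative[OF nd] laplacian_eq_second_derivative[OF d(1,2)]
      by (simp add: uminus_blinfun.rep_eq)
    ultimately have "- h z \<le> 0"
      by (intro subharmonic_compact_support_nonpos) auto
    moreover have "h z \<le> 0"
      by (intro subharmonic_compact_support_nonpos h) (simp add: lap)
    ultimately show "h z = 0" by simp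
  qed
qed

section \<open>The central limit theorem\<close>

lemma weak_conv_m_offset:
  assumes "weak_conv_m (\<lambda>n. \<mu> (n + k)) \<nu>"
  shows "weak_conv_m \<mu> \<nu>"
  using assms unfolding weak_conv_m_def weak_conv_def by (blast intro: LIMSEQ_offset)

text \<open>
  Measurability and integrability are consequences here: the default value \<open>0\<close> of the integral of a
  non-integrable function has logarithm \<open>0\<close>, which is excluded for large \<open>n\<close> by the positive limit
  \<open>s\<^sup>2 / 2\<close>. The finitely many remaining indices do not affect weak convergence.
\<close>
lemma normal_limit_from_log_mgf:
  fixes N :: "'a measure" and Y :: "nat \<Rightarrow> 'a \<Rightarrow> real"
  assumes N: "prob_space N" and s: "s > 0"
    and lim: "\<And>t. t \<noteq> 0 \<Longrightarrow> (\<lambda>n. ln (LINT \<omega>|N. exp (t * Y n \<omega>)) / t\<^sup>2) \<longlonglongrightarrow> s\<^sup>2 / 2"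
  shows "weak_conv_m (\<lambda>n. distr N borel (Y n))
           (density lborel (\<lambda>x. ennreal (normal_density 0 s x)))"
proof -
  interpret prob_space N by fact
  let ?m = "\<lambda>n t. LINT \<omega>|N. exp (t * Y n \<omega>)"
  have nz: "\<forall>\<^sub>F n in sequentially. ?m n t \<noteq> 0" if "t \<noteq> 0" for t
    using order_tendstoD(1)[OF lim[OF that], of 0] s
    by (auto elim!: eventually_mono)
  have "\<forall>\<^sub>F n in sequentially. integrable N (\<lambda>\<omega>. exp (t * Y n \<omega>))" if "t \<noteq> 0" for t
    using nz[OF that] by (rule eventually_mono) (metis not_integrable_integral_eq)
  from eventually_conj[OF this[of 1] this[of "- 1"]]
  obtain k where k: "\<And>n. n \<ge> k \<Longrightarrow> integrable N (\<lambda>\<omega>. exp (1 * Y n \<omega>))"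
      "\<And>n. n \<ge> k \<Longrightarrow> integrable N (\<lambda>\<omega>. exp (- 1 * Y n \<omega>))"
    by (auto simp: eventually_sequentially)
  \<comment> \<open>An integrable function is measurable, so \<open>Y (n + k)\<close> is the logarithm of a measurable function.\<close>
  have meas [measurable]: "Y (n + k) \<in> borel_measurable N" for n
    using borel_measurable_ln[OF borel_measurable_integrable[OF k(1)[of "n + k"]]] by simp
  have int: "integrable N (\<lambda>\<omega>. exp (t * Y (n + k) \<omega>))" if "\<bar>t\<bar> \<le> 1" for n t
  proof (rule Bochner_Integration.integrable_bound[OF Bochner_Integration.integrable_add[OF k]])
    have "exp (t * y) \<le> exp (1 * y) + exp (- 1 * y)" for y
    proof (rule order_trans[OF _ exp_mult_abs_le[OF that]])
      show "exp (t * y) \<le> exp (\<bar>t\<bar> * \<bar>y\<bar>)" by (simp flip: abs_mult)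
    qed
    then show "AE \<omega> in N. norm (exp (t * Y (n + k) \<omega>))
        \<le> norm (exp (1 * Y (n + k) \<omega>) + exp (- 1 * Y (n + k) \<omega>))"
      by (intro AE_I2) (simp add: abs_of_pos add_pos_pos)
  qed simp_all
  have mlim: "(\<lambda>n. ?m n t) \<longlonglongrightarrow> exp (s\<^sup>2 * t\<^sup>2 / 2)" for t
  proof (cases "t = 0")
    case True
    then show ?thesis by (simp add: prob_space)
  next
    case False
    have "(\<lambda>n. exp (t\<^sup>2 * (ln (?m n t) / t\<^sup>2))) \<longlonglongrightarrow> exp (t\<^sup>2 * (s\<^sup>2 / 2))"
      by (intro tendsto_intros lim False)
    moreover have "\<forall>\<^sub>F n in sequentially. exp (t\<^sup>2 * (ln (?m n t) / t\<^sup>2)) = ?m n t"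
      using nz[OF False]
    proof (rule eventually_mono)
      fix n assume "?m n t \<noteq> 0"
      moreover have "?m n t \<ge> 0" by (rule Bochner_Integration.integral_nonneg) simp
      ultimately have "?m n t > 0" by (simp add: less_le)
      then show "exp (t\<^sup>2 * (ln (?m n t) / t\<^sup>2)) = ?m n t" using False by simp
    qed
    ultimately show ?thesis
      using tendsto_cong by (fastforce simp: mult.commute)
  qed
  have "weak_conv_m (\<lambda>n. distr N borel (Y (n + k)))
           (density lborel (\<lambda>x. ennreal (normal_density 0 s x)))"
  proof (rule Curtiss_continuity[where a = 1])
    show "real_distribution (distr N borel (Y (n + k)))" for n
      by (intro real_distribution_distr meas)
    show "real_distribution (density lborel (\<lambda>x. ennreal (normal_density 0 s x)))"
      using prob_space_normal_density[OF s] by (simp add: real_distribution_def real_distribution_axioms_def)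
    show "integrable (distr N borel (Y (n + k))) (\<lambda>x. exp (t * x))" if "\<bar>t\<bar> \<le> 1" for n t
      using int[OF that] by (subst integrable_distr_eq) simp_all
    show "integrable (density lborel (\<lambda>x. ennreal (normal_density 0 s x))) (\<lambda>x. exp (t * x))" for t
      using normal_mgf[OF s] by (simp add: has_bochner_integral_iff)
    show "(\<lambda>n. LINT x|distr N borel (Y (n + k)). exp (t * x))
        \<longlonglongrightarrow> (LINT x|density lborel (\<lambda>x. ennreal (normal_density 0 s x)). exp (t * x))" for t
      using LIMSEQ_ignore_initial_segment[OF mlim[of t], of k] has_bochner_integral_integral_eq[OF normal_mgf[OF s, of t]]
      by (simp add: integral_distr)
  qed simp
  then show ?thesis by (rule weak_conv_m_offset)
qed

theorem corollary7:
  fixes M :: "'a measure" and \<zeta> :: "nat \<Rightarrow> 'a \<Rightarrow> complex"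
    and \<sigma> :: real and h :: "complex \<Rightarrow> real"
  assumes "prob_space M"
    and "prob_space.indep_vars M (\<lambda>_. borel) \<zeta> UNIV"
    and "\<And>k. distributed M lborel (\<zeta> k) (\<lambda>z. ennreal (std_complex_gaussian_density z))"
    and "\<sigma> > 0"
    and "\<And>g :: complex \<Rightarrow> real. C2_real g \<Longrightarrow> compactly_supported g \<Longrightarrow>
           \<forall>\<epsilon>>0. \<exists>R. \<exists>\<delta>>0. \<forall>r\<ge>R. \<forall>\<theta>. \<theta> \<noteq> 0 \<and> \<bar>\<theta>\<bar> * (ln r)\<^sup>2 \<le> \<delta> \<longrightarrow>
             \<bar>scaled_log_mgf M \<zeta> g r \<theta> - \<sigma>\<^sup>2 / 2 * (LINT z|lborel. \<bar>laplacian g z\<bar>\<^sup>2)\<bar> < \<epsilon>"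
    and "C2_real h" and "compactly_supported h"
  shows "\<forall>\<rho> :: nat \<Rightarrow> real. filterlim \<rho> at_top sequentially \<longrightarrow>
           weak_conv_m
             (\<lambda>n. distr (completion M) borel
                    (\<lambda>\<omega>. \<rho> n * centered_zero_sum (gaussian_entire (\<lambda>k. \<zeta> k \<omega>)) h (\<rho> n)))
             (normal_law 0 (\<sigma>\<^sup>2 * (LINT z|lborel. \<bar>laplacian h z\<bar>\<^sup>2)))"
proof (intro allI impI)
  fix \<rho> :: "nat \<Rightarrow> real" assume \<rho>: "filterlim \<rho> at_top sequentially"
  define V where "V = (LINT z|lborel. \<bar>laplacian h z\<bar>\<^sup>2)"
  define X where "X n \<omega> = centered_zero_sum (gaussian_entire (\<lambda>k. \<zeta> k \<omega>)) h (\<rho> n)" for n \<omega>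
  have M: "prob_space (completion M)"
    using assms(1) by (rule prob_space.prob_space_completion)
  have "V \<ge> 0" unfolding V_def by (rule Bochner_Integration.integral_nonneg) simp
  have "weak_conv_m (\<lambda>n. distr (completion M) borel (\<lambda>\<omega>. \<rho> n * X n \<omega>)) (normal_law 0 (\<sigma>\<^sup>2 * V))"
  proof (cases "V = 0")
    case True
    then have "h = (\<lambda>_. 0)"
      using eq_0_if_laplacian_energy_0 assms(6,7) by (simp add: V_def)
    then have "X n \<omega> = 0" for n \<omega> 
      by (simp add: X_def centered_zero_sum_def)
    moreover have "distr (completion M) borel (\<lambda>_. 0) = return borel (0::real)"
      using M prob_space.prob_space by (intro prob_space.distr_const) auto
    ultimately show ?thesis
      using True by (simp add: normal_law_def weak_conv_m_def weak_conv_def)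
  next
    case False
    with \<open>V \<ge> 0\<close> \<open>\<sigma> > 0\<close> have pos: "\<sigma>\<^sup>2 * V > 0" by simp
    have lim: "(\<lambda>n. ln (LINT \<omega>|completion M. exp (t * (\<rho> n * X n \<omega>))) / t\<^sup>2) \<longlonglongrightarrow> (sqrt (\<sigma>\<^sup>2 * V))\<^sup>2 / 2"
      if t: "t \<noteq> 0" for t
    proof (rule tendstoI)
      fix \<epsilon> :: real assume "\<epsilon> > 0"
      with assms(5-7) obtain R \<delta> where "\<delta> > 0" and R: "\<And>r \<theta>. r \<ge> R \<Longrightarrow> \<theta> \<noteq> 0 \<Longrightarrow> \<bar>\<theta>\<bar> * (ln r)\<^sup>2 \<le> \<delta>
          \<Longrightarrow> \<bar>scaled_log_mgf M \<zeta> h r \<theta> - \<sigma>\<^sup>2 / 2 * V\<bar> < \<epsilon>"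
        unfolding V_def by metis
      have "((\<lambda>r::real. (ln r)\<^sup>2 / r) \<longlongrightarrow> 0) at_top" by real_asymp
      then have "((\<lambda>r::real. \<bar>t\<bar> * ((ln r)\<^sup>2 / r)) \<longlongrightarrow> 0) at_top"
        by (rule tendsto_mult_right_zero)
      then have "\<forall>\<^sub>F r in at_top. \<bar>t\<bar> * ((ln r)\<^sup>2 / r) < \<delta>"
        using \<open>\<delta> > 0\<close> by (rule order_tendstoD)
      then have "\<forall>\<^sub>F r in at_top. r > 0 \<and> r \<ge> R \<and> \<bar>t\<bar> * ((ln r)\<^sup>2 / r) < \<delta>"
        by (intro eventually_conj eventually_gt_at_top eventually_ge_at_top)
      then have "\<forall>\<^sub>F n in sequentially. \<rho> n > 0 \<and> \<rho> n \<ge> R \<and> \<bar>t\<bar> * ((ln (\<rho> n))\<^sup>2 / \<rho> n) < \<delta>"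
        using \<rho> by (rule eventually_compose_filterlim)
      then show "\<forall>\<^sub>F n in sequentially. dist (ln (LINT \<omega>|completion M. exp (t * (\<rho> n * X n \<omega>))) / t\<^sup>2)
          ((sqrt (\<sigma>\<^sup>2 * V))\<^sup>2 / 2) < \<epsilon>"
      proof (rule eventually_mono)
        fix n assume n: "\<rho> n > 0 \<and> \<rho> n \<ge> R \<and> \<bar>t\<bar> * ((ln (\<rho> n))\<^sup>2 / \<rho> n) < \<delta>"
        \<comment> \<open>With \<open>\<theta> = t / r\<close> the normalization \<open>r\<^sup>2 * \<theta>\<^sup>2\<close> is \<open>t\<^sup>2\<close> and the exponent \<open>\<theta> * r\<^sup>2\<close> is \<open>t * r\<close>.\<close>
        then have "scaled_log_mgf M \<zeta> h (\<rho> n) (t / \<rho> n)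
            = ln (LINT \<omega>|completion M. exp (t * (\<rho> n * X n \<omega>))) / t\<^sup>2"
          by (simp add: scaled_log_mgf_def X_def power2_eq_square mult.assoc)
        then show "dist (ln (LINT \<omega>|completion M. exp (t * (\<rho> n * X n \<omega>))) / t\<^sup>2)
          ((sqrt (\<sigma>\<^sup>2 * V))\<^sup>2 / 2) < \<epsilon>"
          using R[of "\<rho> n" "t / \<rho> n"] n t pos by (simp add: dist_real_def)
      qed
    qed
    have "sqrt (\<sigma>\<^sup>2 * V) > 0" using pos by simp
    from normal_limit_from_log_mgf[OF M this lim] show ?thesis
      using False \<open>\<sigma> > 0\<close> by (simp add: normal_law_def)
  qed
  then show "weak_conv_m
             (\<lambda>n. distr (completion M) borel
                    (\<lambda>\<omega>. \<rho> n * centered_zero_sum (gaussian_entire (\<lambda>k. \<zeta> k \<omega>)) h (\<rho> n)))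
             (normal_law 0 (\<sigma>\<^sup>2 * (LINT z|lborel. \<bar>laplacian h z\<bar>\<^sup>2)))"
    by (simp add: X_def V_def)
qed

end
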